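(* For every finitary signature $\Sigma$ and every set $\mathcal{E}\subseteq T_\Sigma(V)\times T_\Sigma(V)$ of inequalities, the forgetful functor $U:\mathbf{DTop}(\Sigma,\mathcal{E})\to\mathbf{DTop}$ has a left adjoint. Equivalently, for each directed space $X$, the free algebra over $X$ with respect to $\mathbf{DTop}(\Sigma,\mathcal{E})$ exists.
   Context: All topological spaces are $T_0$. The specialization order on a space $X$ is $x\sqsubseteq y$ iff $x\in\overline{\{y\}}$; all order-theoretic notions refer to it. A directed subset $D\subseteq X$ converges to $x$, written $D\to x$, if $D\cap U\neq\emptyset$ for every open neighbourhood $U$ of $x$. A subset $U\subseteq X$ is directed-open if for every directed $D\subseteq X$ and $x\in X$ with $D\to x$, $x\in U$ implies $D\cap U\ne\emptyset$. A directed space is a $T_0$ space in which every directed-open set is open. For a $T_0$ space $Y$, $\mathcal{D}Y$ is the set of $Y$ with the topology of all directed-open subsets of $Y$ (a directed space). $\mathbf{DTop}$ is the category of directed spaces and continuous maps; its categorical product is $\bigotimes_{j} X_j=\mathcal{D}(\prod_j X_j)$, where $\prod_j X_j$ is the topological product, and $X\otimes Y$ denotes the binary product. For a directed space $X$, $X^n$ denotes the $n$-fold product $X\otimes\dots\otimes X$. A finitary signature $\Sigma=\langle I,\alpha\rangle$ is a set $I$ of operation symbols with an arity map $\alpha:I\to\mathbb{N}$, $n_i:=\alpha(i)$. A $\Sigma$-algebra $\langle A,\{f_i\}_I\rangle$ is a set $A$ with maps $f_i:A^{n_i}\to A$, $i\in I$. A homomorphism $h:\langle A,\{k_i\}_I\rangle\to\langle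 B,\{l_i\}_I\rangle$ is a map $h:A\to B$ with $h(k_i(a_1,\dots,a_{n_i}))=l_i(h(a_1),\dots,h(a_{n_i}))$ for all $i\in I$. $T_\Sigma(V)$ is the term algebra over a fixed countable set $V$ of variables; each map $h:V\to A$ into a $\Sigma$-algebra extends uniquely to a homomorphism $\overline h:T_\Sigma(V)\to A$. A dtop-algebra is a $\Sigma$-algebra whose carrier is a directed space and whose operations $f_i:A^{n_i}\to A$ are continuous. A pair $\langle\tau_1,\tau_2\rangle\in\mathcal{E}$ stands for the inequality $\tau_1\le\tau_2$, which holds in $A$ if $\overline h(\tau_1)\sqsubseteq\overline h(\tau_2)$ for every map $h:V\to A$. $\mathbf{DTop}(\Sigma,\mathcal{E})$ is the category of all dtop-algebras with signature $\Sigma$ satisfying all inequalities in $\mathcal{E}$, with continuous homomorphisms as morphisms; $U$ sends an algebra to its carrier space. The free algebra over a directed space $X$ with respect to $\mathbf{DTop}(\Sigma,\mathcal{E})$ is an object $\langle A,\{f_i\}_I\rangle$ of $\mathbf{DTop}(\Sigma,\mathcal{E})$ together with a continuous map $i:X\to A$ such that for every object $\langle B,\{g_i\}_I\rangle$ of $\mathbf{DTop}(\Sigma,\mathcal{E})$ and every continuous map $f:X\to B$ there is a unique continuous homomorphism $\overline f:\langle A,\{f_i\}_I\rangle\to\langle B,\{g_i\}_I\rangle$ with $\overline f\circ i=f$. *)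

theory Defs
  imports "HOL-Analysis.Analysis"
begin

section \<open>Directed spaces\<close>

text \<open>A space is a value of the library type \<open>'a topology\<close>; its set of points is
  \<^const>\<open>topspace\<close>, an arbitrary (possibly empty) subset of the type.\<close>

definition spec_le :: "'a topology \<Rightarrow> 'a \<Rightarrow> 'a \<Rightarrow> bool" where
  "spec_le X x y \<longleftrightarrow> x \<in> X closure_of {y}"

definition directed_subset :: "'a topology \<Rightarrow> 'a set \<Rightarrow> bool" where
  "directed_subset X D \<longleftrightarrow>
     D \<subseteq> topspace X \<and> D \<noteq> {} \<and>
     (\<forall>a\<in>D. \<forall>b\<in>D. \<exists>c\<in>D. spec_le X a c \<and> spec_le X b c)"

definition dir_converges :: "'a topology \<Rightarrow> 'a set \<Rightarrow> 'a \<Rightarrow> bool" where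
  "dir_converges X D x \<longleftrightarrow> (\<forall>U. openin X U \<and> x \<in> U \<longrightarrow> D \<inter> U \<noteq> {})"

definition directed_open :: "'a topology \<Rightarrow> 'a set \<Rightarrow> bool" where
  "directed_open X U \<longleftrightarrow>
     U \<subseteq> topspace X \<and>
     (\<forall>D x. directed_subset X D \<and> x \<in> topspace X \<and> dir_converges X D x \<and> x \<in> U
        \<longrightarrow> D \<inter> U \<noteq> {})"

definition directed_space :: "'a topology \<Rightarrow> bool" where
  "directed_space X \<longleftrightarrow> t0_space X \<and> (\<forall>U. directed_open X U \<longrightarrow> openin X U)"

definition Dtop :: "'a topology \<Rightarrow> 'a topology" where
  "Dtop X = topology (directed_open X)"

lemma istopology_directed_open: "istopology (directed_open X)"
  unfolding istopology_def
proof (intro conjI allI impI)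
  fix U V assume U: "directed_open X U" and V: "directed_open X V"
  have up: "b \<in> W" if W: "directed_open X W" and a: "a \<in> W" and ab: "spec_le X a b" for W a b
  proof -
    have b: "b \<in> topspace X" and a': "a \<in> topspace X"
      using ab by (auto simp: spec_le_def in_closure_of dest: openin_subset)
    have "directed_subset X {b}"
      using b by (auto simp: directed_subset_def spec_le_def in_closure_of)
    moreover have "dir_converges X {b} a"
      using ab by (auto simp: dir_converges_def spec_le_def in_closure_of)
    ultimately show ?thesis
      using W a a' unfolding directed_open_def by blast
  qed
  show "directed_open X (U \<inter> V)"
    unfolding directed_open_def
  proof (intro conjI allI impI)
    show "U \<inter> V \<subseteq> topspace X"
      using U by (auto simp: directed_open_def)
  next
    fix D x
    assume *: "directed_subset X D \<and> x \<in> topspace X \<and> dir_converges X D x \<and> x \<in> U \<inter> V"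
    obtain a where a: "a \<in> D" "a \<in> U" using * U unfolding directed_open_def by blast
    obtain b where b: "b \<in> D" "b \<in> V" using * V unfolding directed_open_def by blast
    obtain c where "c \<in> D" "spec_le X a c" "spec_le X b c"
      using * a b unfolding directed_subset_def by blast
    then show "D \<inter> (U \<inter> V) \<noteq> {}"
      using up[OF U] up[OF V] a b by blast
  qed
next
  fix K assume "\<forall>U\<in>K. directed_open X U"
  then show "directed_open X (\<Union>K)"
    unfolding directed_open_def by blast
qed

lemma openin_Dtop: "openin (Dtop X) U \<longleftrightarrow> directed_open X U"
  by (simp add: Dtop_def istopology_directed_open)

lemma topspace_Dtop: "topspace (Dtop X) = topspace X"
proof
  show "topspace (Dtop X) \<subseteq> topspace X"
    using openin_topspace[of "Dtop X"] unfolding openin_Dtop directed_open_def by blast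
  have "directed_open X (topspace X)"
    unfolding directed_open_def directed_subset_def by blast
  then show "topspace X \<subseteq> topspace (Dtop X)"
    by (metis openin_Dtop openin_subset)
qed

text \<open>The \<open>n\<close>-fold product of \<open>X\<close> in the category of directed spaces; its points are the
  tuples \<open>{..<n} \<rightarrow>\<^sub>E topspace X\<close>.\<close>

definition dir_power :: "'a topology \<Rightarrow> nat \<Rightarrow> (nat \<Rightarrow> 'a) topology" where
  "dir_power X n = Dtop (product_topology (\<lambda>_. X) {..<n})"

text \<open>Morphisms are represented by functions that are \<^const>\<open>undefined\<close> off the domain space, so
  that two morphisms agreeing on all points are equal; they are composed with
  \<^const>\<open>compose\<close>.\<close>

definition DTop_hom :: "'a topology \<Rightarrow> 'b topology \<Rightarrow> ('a \<Rightarrow> 'b) set" where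
  "DTop_hom X Y = {f \<in> extensional (topspace X). continuous_map X Y f}"


section \<open>Signatures, terms and algebras\<close>

record 'i signature =
  symbols :: "'i set"
  arity :: "'i \<Rightarrow> nat"

datatype ('i, 'v) trm = Var 'v | Op 'i "('i, 'v) trm list"

text \<open>\<open>terms S\<close> is the set of terms respecting the symbols and arities of \<open>S\<close>, over the
  whole variable type \<open>'v\<close>.\<close>

inductive_set terms :: "'i signature \<Rightarrow> ('i, 'v) trm set" for S where
  Var: "Var v \<in> terms S"
| Op: "\<lbrakk>i \<in> symbols S; length ts = arity S i; \<forall>t\<in>set ts. t \<in> terms S\<rbrakk> \<Longrightarrow> Op i ts \<in> terms S"

record ('i, 'a) dtop_alg =
  carr :: "'a topology"
  ops :: "'i \<Rightarrow> (nat \<Rightarrow> 'a) \<Rightarrow> 'a"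

definition dtop_algebra :: "'i signature \<Rightarrow> ('i, 'a) dtop_alg \<Rightarrow> bool" where
  "dtop_algebra S A \<longleftrightarrow>
     directed_space (carr A) \<and>
     (\<forall>i\<in>symbols S. continuous_map (dir_power (carr A) (arity S i)) (carr A) (ops A i))"

primrec eval :: "('i, 'a) dtop_alg \<Rightarrow> ('v \<Rightarrow> 'a) \<Rightarrow> ('i, 'v) trm \<Rightarrow> 'a" where
  "eval A h (Var v) = h v"
| "eval A h (Op i ts) = ops A i (\<lambda>k\<in>{..<length ts}. map (eval A h) ts ! k)"

text \<open>The countable set of variables of the inequalities is the type \<open>nat\<close>.\<close>

type_synonym 'i inequality = "('i, nat) trm \<times> ('i, nat) trm"

definition satisfies :: "('i, 'a) dtop_alg \<Rightarrow> 'i inequality set \<Rightarrow> bool" where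
  "satisfies A E \<longleftrightarrow>
     (\<forall>(t1, t2)\<in>E. \<forall>h. range h \<subseteq> topspace (carr A) \<longrightarrow>
        spec_le (carr A) (eval A h t1) (eval A h t2))"

definition DTopAlg :: "'i signature \<Rightarrow> 'i inequality set \<Rightarrow> ('i, 'a) dtop_alg set" where
  "DTopAlg S E = {A. dtop_algebra S A \<and> satisfies A E}"

definition homomorphism ::
  "'i signature \<Rightarrow> ('i, 'a) dtop_alg \<Rightarrow> ('i, 'b) dtop_alg \<Rightarrow> ('a \<Rightarrow> 'b) \<Rightarrow> bool" where
  "homomorphism S A B h \<longleftrightarrow>
     h ` topspace (carr A) \<subseteq> topspace (carr B) \<and>
     (\<forall>i\<in>symbols S. \<forall>a\<in>{..<arity S i} \<rightarrow>\<^sub>E topspace (carr A).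
        h (ops A i a) = ops B i (\<lambda>k\<in>{..<arity S i}. h (a k)))"

definition DTopAlg_hom ::
  "'i signature \<Rightarrow> ('i, 'a) dtop_alg \<Rightarrow> ('i, 'b) dtop_alg \<Rightarrow> ('a \<Rightarrow> 'b) set" where
  "DTopAlg_hom S A B = {h \<in> DTop_hom (carr A) (carr B). homomorphism S A B h}"


section \<open>Free algebras and left adjoints of the forgetful functor\<close>

text \<open>HOL cannot quantify over types within a formula. The argument \<open>TYPE('b)\<close> says that the
  target algebras \<open>B\<close> range over all algebras whose carrier is a subset of \<open>'b\<close>.\<close>

definition free_algebra ::
  "'b itself \<Rightarrow> 'i signature \<Rightarrow> 'i inequality set \<Rightarrow> 'x topology
     \<Rightarrow> ('i, 'a) dtop_alg \<Rightarrow> ('x \<Rightarrow> 'a) \<Rightarrow> bool" where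
  "free_algebra (_ :: 'b itself) S E X A \<eta> \<longleftrightarrow>
     A \<in> DTopAlg S E \<and> continuous_map X (carr A) \<eta> \<and>
     (\<forall>(B :: ('i, 'b) dtop_alg) \<in> DTopAlg S E. \<forall>f. continuous_map X (carr B) f \<longrightarrow>
        (\<exists>!g. g \<in> DTopAlg_hom S A B \<and> (\<forall>x\<in>topspace X. g (\<eta> x) = f x)))"

text \<open>\<open>F\<close> on objects and \<open>Fm\<close> on morphisms form a functor from directed spaces on \<open>'x\<close> to the
  dtop-algebras satisfying the inequalities.\<close>

definition is_functor ::
  "'i signature \<Rightarrow> 'i inequality set \<Rightarrow> ('x topology \<Rightarrow> ('i, 'a) dtop_alg)
     \<Rightarrow> ('x topology \<Rightarrow> 'x topology \<Rightarrow> ('x \<Rightarrow> 'x) \<Rightarrow> ('a \<Rightarrow> 'a)) \<Rightarrow> bool" where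
  "is_functor S E F Fm \<longleftrightarrow>
     (\<forall>X. directed_space X \<longrightarrow> F X \<in> DTopAlg S E) \<and>
     (\<forall>X Y. directed_space X \<and> directed_space Y \<longrightarrow>
        (\<forall>f\<in>DTop_hom X Y. Fm X Y f \<in> DTopAlg_hom S (F X) (F Y))) \<and>
     (\<forall>X. directed_space X \<longrightarrow>
        Fm X X (\<lambda>x\<in>topspace X. x) = (\<lambda>a\<in>topspace (carr (F X)). a)) \<and>
     (\<forall>X Y Z. directed_space X \<and> directed_space Y \<and> directed_space Z \<longrightarrow>
        (\<forall>f\<in>DTop_hom X Y. \<forall>g\<in>DTop_hom Y Z.
           Fm X Z (compose (topspace X) g f)
             = compose (topspace (carr (F X))) (Fm Y Z g) (Fm X Y f)))"

text \<open>The forgetful functor is \<^const>\<open>carr\<close> on objects and the identity on morphisms; \<open>\<Phi> X B\<close> is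
  the natural bijection from homomorphisms \<open>F X \<rightarrow> B\<close> to continuous maps \<open>X \<rightarrow> carr B\<close>.\<close>

definition left_adjoint_forgetful ::
  "'b itself \<Rightarrow> 'i signature \<Rightarrow> 'i inequality set \<Rightarrow> ('x topology \<Rightarrow> ('i, 'a) dtop_alg)
     \<Rightarrow> ('x topology \<Rightarrow> 'x topology \<Rightarrow> ('x \<Rightarrow> 'x) \<Rightarrow> ('a \<Rightarrow> 'a)) \<Rightarrow> bool" where
  "left_adjoint_forgetful (_ :: 'b itself) S E F Fm \<longleftrightarrow>
     is_functor S E F Fm \<and>
     (\<exists>\<Phi> :: 'x topology \<Rightarrow> ('i, 'b) dtop_alg \<Rightarrow> ('a \<Rightarrow> 'b) \<Rightarrow> ('x \<Rightarrow> 'b).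
        (\<forall>X B. directed_space X \<and> B \<in> DTopAlg S E \<longrightarrow>
           bij_betw (\<Phi> X B) (DTopAlg_hom S (F X) B) (DTop_hom X (carr B))) \<and>
        (\<forall>X Y B. directed_space X \<and> directed_space Y \<and> B \<in> DTopAlg S E \<longrightarrow>
           (\<forall>f\<in>DTop_hom X Y. \<forall>h\<in>DTopAlg_hom S (F Y) B.
              \<Phi> X B (compose (topspace (carr (F X))) h (Fm X Y f))
                = compose (topspace X) (\<Phi> Y B h) f)) \<and>
        (\<forall>X B C. directed_space X \<and> B \<in> DTopAlg S E \<and> C \<in> DTopAlg S E \<longrightarrow>
           (\<forall>g\<in>DTopAlg_hom S B C. \<forall>h\<in>DTopAlg_hom S (F X) B.
              \<Phi> X C (compose (topspace (carr (F X))) g h)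
                = compose (topspace X) g (\<Phi> X B h))))"

text \<open>A concrete type on which free algebras over spaces on \<open>'x\<close> live: congruence classes of
  terms over \<open>'x\<close>. The theorem claims existence with targets ranging over this same type,
  and then that every free algebra (left adjoint) in this sense is one for targets on an arbitrary
  type \<open>'b\<close>. The first claim does not mention \<open>'b\<close>, so one and the same free algebra serves
  for all target types.\<close>

type_synonym ('i, 'x) trm_class = "('i, 'x) trm set"

end

theory Submission
  imports Defs
begin

text \<open>The argument is the one behind the adjoint functor theorem, made concrete so that the solution
  set is visible. Let \<open>X\<close> be a directed space and let \<open>T\<close> be the set of terms over its points. A
  continuous map \<open>f\<close> from \<open>X\<close> into an algebra \<open>B\<close> evaluates every term of \<open>T\<close> in \<open>B\<close>. Given a set \<open>P\<close>
  of such pairs \<open>(B, f)\<close>, identify two terms when all members of \<open>P\<close> give them the same value. The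
  quotient embeds into the product of the algebras \<open>B\<close>; give it the topology induced by that embedding
  and then apply \<^const>\<open>Dtop\<close>. The result is a dtop-algebra satisfying the inequalities (locale
  \<open>algebra_source\<close>), since continuity, the specialization order and equality can all be tested on the
  factors. The variables give a continuous map from \<open>X\<close> into it, every element is the value of a term
  in these generators, and each \<open>(B, f)\<close> in \<open>P\<close> factors through it by a continuous homomorphism.

  What makes the topology harmless is that \<^const>\<open>Dtop\<close> is a coreflection: it is functorial
  (\<open>continuous_map_Dtop\<close>), idempotent (\<open>Dtop_Dtop\<close>) and keeps the specialization order
  (\<open>spec_le_Dtop\<close>). Hence a map from a directed space, in particular from a power in the category of
  directed spaces, is continuous into \<^term>\<open>Dtop Y\<close> as soon as it is continuous into \<^term>\<open>Y\<close>.

  The construction is used twice. With \<open>P\<close> the set of all pairs whose algebra lives on the type of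
  sets of terms, it yields the free algebra for targets on that type (\<open>free_algebra_exists\<close>). With
  \<open>P\<close> a single pair \<open>(B, f)\<close>, where \<open>B\<close> lives on an arbitrary type, it yields a copy, on the type of
  sets of terms, of the subalgebra of \<open>B\<close> generated by the image of \<open>f\<close>
  (\<open>single_source_algebra\<close>). The universal property on the type of sets of terms can
  be applied to that copy, and this gives the universal property for \<open>B\<close>
  (\<open>free_algebra_any_type\<close>).

  Left adjoints and free algebras are translated into each other by the unit, the image of the
  identity of \<open>F X\<close> under the adjunction bijection; by naturality the unit determines the whole
  bijection.\<close>

section \<open>The directed coreflection\<close>

lemma spec_le_iff:
  "spec_le X x y \<longleftrightarrow>
     x \<in> topspace X \<and> y \<in> topspace X \<and> (\<forall>U. openin X U \<longrightarrow> x \<in> U \<longrightarrow> y \<in> U)"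
  unfolding spec_le_def in_closure_of using openin_topspace[of X] by blast

lemma spec_le_continuous_map:
  assumes "continuous_map X Y f" "spec_le X x y"
  shows "spec_le Y (f x) (f y)"
proof -
  have "f x \<in> f ` (X closure_of {y})"
    using assms(2) by (auto simp: spec_le_def)
  then show ?thesis
    using continuous_map_image_closure_subset[OF assms(1), of "{y}"] by (auto simp: spec_le_def)
qed

lemma t0_space_iff_spec_le_antisym:
  "t0_space X \<longleftrightarrow> (\<forall>x y. spec_le X x y \<longrightarrow> spec_le X y x \<longrightarrow> x = y)"
proof
  assume t0: "t0_space X"
  show "\<forall>x y. spec_le X x y \<longrightarrow> spec_le X y x \<longrightarrow> x = y"
    using t0 unfolding t0_space_def spec_le_iff by meson
next
  assume anti: "\<forall>x y. spec_le X x y \<longrightarrow> spec_le X y x \<longrightarrow> x = y"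
  show "t0_space X"
    unfolding t0_space_def
  proof (intro ballI impI)
    fix x y assume "x \<in> topspace X" "y \<in> topspace X" "x \<noteq> y"
    then have "\<not> (spec_le X x y \<and> spec_le X y x)"
      using anti by blast
    with \<open>x \<in> topspace X\<close> \<open>y \<in> topspace X\<close> show "\<exists>U. openin X U \<and> (x \<notin> U \<longleftrightarrow> y \<in> U)"
      unfolding spec_le_iff by blast
  qed
qed

lemma directed_subset_continuous_image:
  assumes "continuous_map X Y f" "directed_subset X D"
  shows "directed_subset Y (f ` D)"
proof -
  have "f ` D \<subseteq> topspace Y"
    using assms continuous_map_image_subset_topspace unfolding directed_subset_def by blast
  moreover have "f ` D \<noteq> {}"
    using assms(2) by (auto simp: directed_subset_def)
  moreover have "\<forall>a\<in>f ` D. \<forall>b\<in>f ` D. \<exists>c\<in>f ` D. spec_le Y a c \<and> spec_le Y b c"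
    using assms(2) spec_le_continuous_map[OF assms(1)] unfolding directed_subset_def by blast
  ultimately show ?thesis
    by (simp add: directed_subset_def)
qed

lemma dir_converges_continuous_image:
  assumes f: "continuous_map X Y f" and D: "D \<subseteq> topspace X" and x: "x \<in> topspace X"
    and lim: "dir_converges X D x"
  shows "dir_converges Y (f ` D) (f x)"
  unfolding dir_converges_def
proof (intro allI impI)
  fix U assume U: "openin Y U \<and> f x \<in> U"
  then have "openin X {z \<in> topspace X. f z \<in> U}"
    using f by (simp add: continuous_map_def)
  then have "D \<inter> {z \<in> topspace X. f z \<in> U} \<noteq> {}"
    using lim U x unfolding dir_converges_def by blast
  then show "f ` D \<inter> U \<noteq> {}"
    by blast
qed

lemma directed_openD:
  assumes "directed_open X U" "directed_subset X D" "dir_converges X D x" "x \<in> U"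
  shows "D \<inter> U \<noteq> {}"
proof -
  have "x \<in> topspace X"
    using assms(1,4) by (auto simp: directed_open_def)
  with assms show ?thesis
    unfolding directed_open_def by metis
qed

lemma openin_imp_directed_open: "openin X U \<Longrightarrow> directed_open X U"
  using openin_subset[of X U] by (simp add: directed_open_def dir_converges_def)

text \<open>Two points related by the specialization order form a singleton directed set converging
  to the lower one, so directed-open sets are upper sets.\<close>

lemma directed_open_upper:
  assumes U: "directed_open X U" and "x \<in> U" and xy: "spec_le X x y"
  shows "y \<in> U"
proof -
  have "directed_subset X {y}" "dir_converges X {y} x"
    using xy by (auto simp: directed_subset_def dir_converges_def spec_le_iff)
  then show ?thesis
    using directed_openD[OF U] \<open>x \<in> U\<close> by blast
qed

text \<open>More open sets can only shrink the specialization order, but the additional ones are upper sets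
  for the old order.\<close>

lemma spec_le_Dtop: "spec_le (Dtop X) = spec_le X"
proof (intro ext iffI)
  fix x y assume "spec_le (Dtop X) x y"
  then show "spec_le X x y"
    by (simp add: spec_le_iff topspace_Dtop openin_Dtop openin_imp_directed_open)
next
  fix x y assume xy: "spec_le X x y"
  then show "spec_le (Dtop X) x y"
    using directed_open_upper[OF _ _ xy]
    by (simp add: spec_le_iff[of "Dtop X"] spec_le_iff[of X] topspace_Dtop openin_Dtop)
qed

lemma directed_subset_Dtop: "directed_subset (Dtop X) D \<longleftrightarrow> directed_subset X D"
  by (simp add: directed_subset_def spec_le_Dtop topspace_Dtop)

text \<open>Convergence of directed sets does not see the additional open sets either: directed-openness
  is exactly the demand that every directed set converging into the set meets it. This is why
  \<^const>\<open>Dtop\<close> is idempotent.\<close>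

lemma dir_converges_Dtop:
  assumes "directed_subset X D" "x \<in> topspace X"
  shows "dir_converges (Dtop X) D x \<longleftrightarrow> dir_converges X D x"
proof
  assume "dir_converges (Dtop X) D x"
  then show "dir_converges X D x"
    by (simp add: dir_converges_def openin_Dtop openin_imp_directed_open)
next
  assume "dir_converges X D x"
  then show "dir_converges (Dtop X) D x"
    using assms by (auto simp: dir_converges_def[of "Dtop X"] openin_Dtop directed_open_def)
qed

lemma directed_open_Dtop: "directed_open (Dtop X) U \<longleftrightarrow> directed_open X U"
proof -
  have "directed_subset (Dtop X) D \<and> x \<in> topspace (Dtop X) \<and> dir_converges (Dtop X) D x \<and> x \<in> U
      \<longleftrightarrow> directed_subset X D \<and> x \<in> topspace X \<and> dir_converges X D x \<and> x \<in> U" for D x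
    using dir_converges_Dtop[of X D x] by (auto simp: directed_subset_Dtop topspace_Dtop)
  then show ?thesis
    by (simp only: directed_open_def topspace_Dtop)
qed

lemma directed_space_Dtop:
  assumes "t0_space X"
  shows "directed_space (Dtop X)"
  using assms
  by (simp add: directed_space_def t0_space_iff_spec_le_antisym spec_le_Dtop
      directed_open_Dtop openin_Dtop)

lemma continuous_map_Dtop_id: "continuous_map (Dtop X) X (\<lambda>x. x)"
proof -
  have "{x \<in> topspace X. x \<in> U} = U" if "openin X U" for U
    using openin_subset[OF that] by blast
  then show ?thesis
    by (simp add: continuous_map_def openin_Dtop topspace_Dtop openin_imp_directed_open)
qed

text \<open>Continuous maps preserve directed sets and their convergence, so preimages of directed-open
  sets are directed-open.\<close>

lemma continuous_map_Dtop:
  assumes f: "continuous_map X Y f"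
  shows "continuous_map (Dtop X) (Dtop Y) f"
  unfolding continuous_map_def topspace_Dtop openin_Dtop
proof (intro conjI allI impI)
  show "f \<in> topspace X \<rightarrow> topspace Y"
    using f by (simp add: continuous_map_def)
next
  fix U assume U: "directed_open Y U"
  show "directed_open X {x \<in> topspace X. f x \<in> U}"
    unfolding directed_open_def
  proof (intro conjI allI impI)
    fix D x
    assume *: "directed_subset X D \<and> x \<in> topspace X \<and> dir_converges X D x
                 \<and> x \<in> {x \<in> topspace X. f x \<in> U}"
    then have D: "D \<subseteq> topspace X"
      by (simp add: directed_subset_def)
    have "directed_subset Y (f ` D)"
      using * by (intro directed_subset_continuous_image[OF f]) simp
    moreover have "dir_converges Y (f ` D) (f x)"
      using * by (intro dir_converges_continuous_image[OF f D]) simp_all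
    ultimately have "f ` D \<inter> U \<noteq> {}"
      using * directed_openD[OF U, of "f ` D" "f x"] by simp
    then show "D \<inter> {x \<in> topspace X. f x \<in> U} \<noteq> {}"
      using D by blast
  qed auto
qed

lemma Dtop_directed_space: "directed_space X \<Longrightarrow> Dtop X = X"
  by (auto simp: topology_eq openin_Dtop directed_space_def intro: openin_imp_directed_open)

lemma Dtop_Dtop: "Dtop (Dtop X) = Dtop X"
  by (simp add: topology_eq openin_Dtop directed_open_Dtop)

text \<open>The universal property of the coreflection, with the domain required to be a fixed point
  of \<^const>\<open>Dtop\<close>: for powers this is an instance of \<open>Dtop_Dtop\<close>.\<close>

lemma continuous_map_into_Dtop:
  assumes "Dtop Z = Z" "continuous_map Z X f"
  shows "continuous_map Z (Dtop X) f"
  using continuous_map_Dtop[OF assms(2)] assms(1) by simp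

lemma topspace_dir_power: "topspace (dir_power X n) = ({..<n} \<rightarrow>\<^sub>E topspace X)"
  by (simp add: dir_power_def topspace_Dtop)

lemma continuous_map_dir_power:
  assumes g: "continuous_map X Y g"
  shows "continuous_map (dir_power X n) (dir_power Y n) (\<lambda>a. \<lambda>k\<in>{..<n}. g (a k))"
  unfolding dir_power_def
proof (rule continuous_map_Dtop)
  have "continuous_map (product_topology (\<lambda>_. X) {..<n}) Y (\<lambda>a. g (a k))" if "k < n" for k
    using continuous_map_compose[OF continuous_map_product_projection[where X = "\<lambda>_. X"] g,
        of k "{..<n}"] that
    by (simp add: o_def)
  then show "continuous_map (product_topology (\<lambda>_. X) {..<n}) (product_topology (\<lambda>_. Y) {..<n})
    (\<lambda>a. \<lambda>k\<in>{..<n}. g (a k))"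
    by (auto simp: continuous_map_componentwise)
qed

section \<open>Terms and homomorphisms\<close>

definition terms_over :: "'i signature \<Rightarrow> 'v set \<Rightarrow> ('i, 'v) trm set" where
  "terms_over S V = {t \<in> terms S. set2_trm t \<subseteq> V}"

lemma terms_over_UNIV [simp]: "terms_over S UNIV = terms S"
  by (simp add: terms_over_def)

lemma Var_in_terms_over: "v \<in> V \<Longrightarrow> Var v \<in> terms_over S V"
  by (simp add: terms_over_def terms.Var)

lemma Op_in_terms_over:
  "\<lbrakk>i \<in> symbols S; length ts = arity S i; \<forall>t\<in>set ts. t \<in> terms_over S V\<rbrakk>
     \<Longrightarrow> Op i ts \<in> terms_over S V"
  by (auto simp: terms_over_def intro!: terms.Op)

lemma terms_over_induct [consumes 1, case_names Var Op]:
  assumes "t \<in> terms_over S V"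
    and "\<And>v. v \<in> V \<Longrightarrow> Q (Var v)"
    and "\<And>i ts. \<lbrakk>i \<in> symbols S; length ts = arity S i;
            \<And>t. t \<in> set ts \<Longrightarrow> t \<in> terms_over S V; \<And>t. t \<in> set ts \<Longrightarrow> Q t\<rbrakk> \<Longrightarrow> Q (Op i ts)"
  shows "Q t"
proof -
  have "t \<in> terms S" "set2_trm t \<subseteq> V"
    using assms(1) by (auto simp: terms_over_def)
  then show ?thesis
  proof (induction rule: terms.induct)
    case (Var v)
    then show ?case using assms(2) by simp
  next
    case (Op i ts)
    have "set2_trm t \<subseteq> V" if "t \<in> set ts" for t
      using Op.prems that by auto
    with Op show ?case
      by (intro assms(3)) (auto simp: terms_over_def)
  qed
qed

lemma eval_Op:
  "length ts = n \<Longrightarrow> eval A h (Op i ts) = ops A i (\<lambda>k\<in>{..<n}. eval A h (ts ! k))"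
  by (auto intro!: arg_cong[where f = "ops A i"])

text \<open>Evaluation uses an assignment on all variables of the type, while generators are only meaningful
  at the points of a space.\<close>

lemma eval_cong:
  assumes "t \<in> terms_over S V" "\<And>v. v \<in> V \<Longrightarrow> h v = h' v"
  shows "eval A h t = eval A h' t"
  using assms(1)
proof (induction rule: terms_over_induct)
  case (Op i ts)
  then show ?case
    by (auto simp: eval_Op[OF refl] simp del: eval.simps
        intro!: arg_cong[where f = "ops A i"] restrict_ext)
qed (use assms(2) in simp)

lemma dtop_algebra_ops_closed:
  assumes "dtop_algebra S A" "i \<in> symbols S" "a \<in> {..<arity S i} \<rightarrow>\<^sub>E topspace (carr A)"
  shows "ops A i a \<in> topspace (carr A)"
proof -
  have "continuous_map (dir_power (carr A) (arity S i)) (carr A) (ops A i)"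
    using assms(1,2) by (simp add: dtop_algebra_def)
  then show ?thesis
    using assms(3) continuous_map_image_subset_topspace topspace_dir_power by blast
qed

lemma eval_in_topspace:
  assumes A: "dtop_algebra S A" and t: "t \<in> terms_over S V"
    and h: "h ` V \<subseteq> topspace (carr A)"
  shows "eval A h t \<in> topspace (carr A)"
  using t
proof (induction rule: terms_over_induct)
  case (Var v)
  then show ?case using h by auto
next
  case (Op i ts)
  then show ?case
    unfolding eval_Op[OF Op(2)] by (intro dtop_algebra_ops_closed[OF A]) auto
qed

lemma eval_homomorphism:
  assumes g: "homomorphism S A B g" and A: "dtop_algebra S A"
    and t: "t \<in> terms_over S V" and h: "h ` V \<subseteq> topspace (carr A)"
  shows "g (eval A h t) = eval B (g \<circ> h) t"
  using t
proof (induction rule: terms_over_induct)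
  case (Op i ts)
  have "(\<lambda>k\<in>{..<arity S i}. eval A h (ts ! k)) \<in> {..<arity S i} \<rightarrow>\<^sub>E topspace (carr A)"
    using Op eval_in_topspace[OF A _ h] by auto
  then have "g (eval A h (Op i ts))
      = ops B i (\<lambda>k\<in>{..<arity S i}. g ((\<lambda>k\<in>{..<arity S i}. eval A h (ts ! k)) k))"
    using g Op(1) unfolding eval_Op[OF Op(2)] homomorphism_def by blast
  also have "\<dots> = eval B (g \<circ> h) (Op i ts)"
    unfolding eval_Op[OF Op(2)] using Op(2,4)
    by (intro arg_cong[where f = "ops B i"] restrict_ext) (simp add: comp_def)
  finally show ?case .
qed simp

lemma homomorphism_compose:
  assumes g: "homomorphism S A B g" and h: "homomorphism S B C h" and A: "dtop_algebra S A"
  shows "homomorphism S A C (compose (topspace (carr A)) h g)"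
  unfolding homomorphism_def
proof (intro conjI ballI)
  show "compose (topspace (carr A)) h g ` topspace (carr A) \<subseteq> topspace (carr C)"
    using g h unfolding homomorphism_def by (force simp: compose_def)
next
  fix i a assume i: "i \<in> symbols S" and a: "a \<in> {..<arity S i} \<rightarrow>\<^sub>E topspace (carr A)"
  let ?ga = "\<lambda>k\<in>{..<arity S i}. g (a k)"
  have ga: "?ga \<in> {..<arity S i} \<rightarrow>\<^sub>E topspace (carr B)"
    using g a unfolding homomorphism_def by auto
  have "compose (topspace (carr A)) h g (ops A i a) = h (ops B i ?ga)"
    using dtop_algebra_ops_closed[OF A i a] g i a
    by (simp add: compose_def homomorphism_def)
  also have "\<dots> = ops C i (\<lambda>k\<in>{..<arity S i}. h (?ga k))"
    using h i ga unfolding homomorphism_def by blast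
  also have "\<dots> = ops C i (\<lambda>k\<in>{..<arity S i}. compose (topspace (carr A)) h g (a k))"
    using a by (intro arg_cong[where f = "ops C i"] restrict_ext) (auto simp: compose_def)
  finally show "compose (topspace (carr A)) h g (ops A i a) = \<dots>" .
qed

lemma DTop_hom_compose:
  assumes "f \<in> DTop_hom X Y" "g \<in> DTop_hom Y Z"
  shows "compose (topspace X) g f \<in> DTop_hom X Z"
proof -
  have "continuous_map X Z (g \<circ> f)"
    using assms by (auto simp: DTop_hom_def intro: continuous_map_compose)
  then have "continuous_map X Z (compose (topspace X) g f)"
    by (rule continuous_map_eq) (simp add: compose_def)
  then show ?thesis
    by (simp add: DTop_hom_def)
qed

lemma DTopAlg_hom_compose:
  assumes "g \<in> DTopAlg_hom S A B" "h \<in> DTopAlg_hom S B C" "dtop_algebra S A"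
  shows "compose (topspace (carr A)) h g \<in> DTopAlg_hom S A C"
  using assms by (auto simp: DTopAlg_hom_def intro: DTop_hom_compose homomorphism_compose)

lemma DTopAlg_hom_id:
  assumes A: "dtop_algebra S A"
  shows "(\<lambda>a\<in>topspace (carr A). a) \<in> DTopAlg_hom S A A"
proof -
  have "continuous_map (carr A) (carr A) (\<lambda>a\<in>topspace (carr A). a)"
    by (rule continuous_map_eq[OF continuous_map_id]) simp
  moreover have "(\<lambda>k\<in>{..<n}. (\<lambda>a\<in>topspace (carr A). a) (a k)) = a"
    if "a \<in> {..<n} \<rightarrow>\<^sub>E topspace (carr A)" for n and a :: "nat \<Rightarrow> 'b"
    using that by (auto simp: fun_eq_iff PiE_iff extensional_def)
  ultimately show ?thesis
    using dtop_algebra_ops_closed[OF A]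
    by (auto simp: DTopAlg_hom_def DTop_hom_def homomorphism_def)
qed

section \<open>The algebra generated by a family of maps\<close>

text \<open>A family of maps with a common domain is called a source. The target algebras live on one
  type \<open>'c\<close>, which is independent of the type of the constructed algebra.\<close>

locale algebra_source =
  fixes S :: "'i signature" and E :: "'i inequality set" and X :: "'x topology"
    and P :: "(('i, 'c) dtop_alg \<times> ('x \<Rightarrow> 'c)) set"
  assumes inequalities: "E \<subseteq> terms S \<times> terms S"
    and directed: "directed_space X"
    and source: "\<And>p. p \<in> P \<Longrightarrow> fst p \<in> DTopAlg S E \<and> continuous_map X (carr (fst p)) (snd p)"
begin

abbreviation T :: "('i, 'x) trm set" where
  "T \<equiv> terms_over S (topspace X)"

definition cls :: "('i, 'x) trm \<Rightarrow> ('i, 'x) trm_class" where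
  "cls t = {s \<in> T. \<forall>p\<in>P. eval (fst p) (snd p) s = eval (fst p) (snd p) t}"

definition rep :: "('i, 'x) trm_class \<Rightarrow> ('i, 'x) trm" where
  "rep c = (SOME t. t \<in> c)"

definition val :: "('i, 'c) dtop_alg \<times> ('x \<Rightarrow> 'c) \<Rightarrow> ('i, 'x) trm_class \<Rightarrow> 'c" where
  "val p c = eval (fst p) (snd p) (rep c)"

text \<open>The topology of the quotient as a subset of the topological product of the targets.\<close>

definition weak :: "('i, 'x) trm_class topology" where
  "weak = pullback_topology (cls ` T) (\<lambda>c. \<lambda>p\<in>P. val p c) (product_topology (\<lambda>p. carr (fst p)) P)"

text \<open>The operations work on representatives; \<open>ops_alg\<close> shows that the values, and hence the
  class of the result, do not depend on their choice.\<close>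

definition alg :: "('i, ('i, 'x) trm_class) dtop_alg" where
  "alg = \<lparr>carr = Dtop weak, ops = (\<lambda>i a. cls (Op i (map (\<lambda>k. rep (a k)) [0..<arity S i])))\<rparr>"

definition gen :: "'x \<Rightarrow> ('i, 'x) trm_class" where
  "gen x = cls (Var x)"

lemma source_algebra: "p \<in> P \<Longrightarrow> dtop_algebra S (fst p)"
  and source_continuous: "p \<in> P \<Longrightarrow> continuous_map X (carr (fst p)) (snd p)"
  and source_satisfies: "p \<in> P \<Longrightarrow> satisfies (fst p) E"
  using source by (auto simp: DTopAlg_def)

lemma rep_cls:
  assumes "t \<in> T"
  shows "rep (cls t) \<in> T" "p \<in> P \<Longrightarrow> eval (fst p) (snd p) (rep (cls t)) = eval (fst p) (snd p) t"
proof -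
  have "rep (cls t) \<in> cls t"
    unfolding rep_def by (rule someI[of _ t]) (use assms in \<open>simp add: cls_def\<close>)
  then show "rep (cls t) \<in> T"
    "p \<in> P \<Longrightarrow> eval (fst p) (snd p) (rep (cls t)) = eval (fst p) (snd p) t"
    by (auto simp: cls_def)
qed

lemma val_cls: "\<lbrakk>p \<in> P; t \<in> T\<rbrakk> \<Longrightarrow> val p (cls t) = eval (fst p) (snd p) t"
  by (simp add: val_def rep_cls)

text \<open>By the choice of the equivalence relation, equality in the quotient can be tested on the
  targets.\<close>

lemma val_jointly_injective:
  assumes "c \<in> cls ` T" "d \<in> cls ` T" "\<And>p. p \<in> P \<Longrightarrow> val p c = val p d"
  shows "c = d"
proof -
  obtain s t where st: "s \<in> T" "t \<in> T" "c = cls s" "d = cls t"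
    using assms(1,2) by blast
  then have "\<forall>p\<in>P. eval (fst p) (snd p) s = eval (fst p) (snd p) t"
    using assms(3) val_cls by metis
  then show ?thesis
    by (auto simp: st(3,4) cls_def)
qed

lemma val_in_topspace:
  assumes p: "p \<in> P" and "c \<in> cls ` T"
  shows "val p c \<in> topspace (carr (fst p))"
proof -
  obtain t where t: "t \<in> T" "c = cls t"
    using assms(2) by blast
  show ?thesis
    using eval_in_topspace[OF source_algebra[OF p] t(1)]
      continuous_map_image_subset_topspace[OF source_continuous[OF p]] by (simp add: val_cls p t)
qed

lemma topspace_weak: "topspace weak = cls ` T"
  using val_in_topspace by (auto simp: weak_def topspace_pullback_topology)

lemma continuous_map_val_weak:
  assumes "p \<in> P"
  shows "continuous_map weak (carr (fst p)) (val p)"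
proof -
  have "continuous_map weak (carr (fst p)) ((\<lambda>f. f p) \<circ> (\<lambda>c. \<lambda>p\<in>P. val p c))"
    unfolding weak_def
    by (intro continuous_map_pullback continuous_map_product_projection assms)
  then show ?thesis
    by (rule continuous_map_eq) (simp add: assms)
qed

lemma continuous_map_into_weak:
  assumes "f \<in> topspace Z \<rightarrow> cls ` T"
    and "\<And>p. p \<in> P \<Longrightarrow> continuous_map Z (carr (fst p)) (val p \<circ> f)"
  shows "continuous_map Z weak f"
  unfolding weak_def
proof (rule continuous_map_pullback')
  show "continuous_map Z (product_topology (\<lambda>p. carr (fst p)) P) ((\<lambda>c. \<lambda>p\<in>P. val p c) \<circ> f)"
    using assms(2) by (auto simp: continuous_map_componentwise o_def)
  show "topspace Z \<subseteq> f -` cls ` T"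
    using assms(1) by blast
qed

text \<open>The specialization order of a product is componentwise because closures of boxes are boxes of
  closures, and it restricts to subspaces. Inequalities therefore pass from the targets to the
  constructed algebra.\<close>

lemma spec_le_weak:
  assumes c: "c \<in> cls ` T" and d: "d \<in> cls ` T"
    and le: "\<And>p. p \<in> P \<Longrightarrow> spec_le (carr (fst p)) (val p c) (val p d)"
  shows "spec_le weak c d"
proof -
  let ?v = "\<lambda>c. \<lambda>p\<in>P. val p c"
  have sing: "(\<Pi>\<^sub>E p\<in>P. {val p d}) = {?v d}"
    by (auto simp: PiE_iff extensional_def fun_eq_iff)
  have "?v c \<in> (\<Pi>\<^sub>E p\<in>P. carr (fst p) closure_of {val p d})"
    using le by (auto simp: spec_le_def)
  then have "spec_le (product_topology (\<lambda>p. carr (fst p)) P) (?v c) (?v d)"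
    unfolding spec_le_def closure_of_product_topology[symmetric] sing .
  then have "?v d \<in> V" if "openin (product_topology (\<lambda>p. carr (fst p)) P) V" "?v c \<in> V" for V
    using that unfolding spec_le_iff by blast
  then have "d \<in> U" if "openin weak U" "c \<in> U" for U
    using that d unfolding weak_def openin_pullback_topology by blast
  then show ?thesis
    using c d by (simp add: spec_le_iff topspace_weak)
qed

lemma topspace_alg: "topspace (carr alg) = cls ` T"
  by (simp add: alg_def topspace_Dtop topspace_weak)

text \<open>Antisymmetry of the specialization order is inherited from the targets, because passing to the
  quotient has made the values jointly injective.\<close>

lemma directed_space_alg: "directed_space (carr alg)"
proof -
  have "c = d" if "spec_le weak c d" "spec_le weak d c" for c d
  proof (rule val_jointly_injective)
    show "c \<in> cls ` T" "d \<in> cls ` T"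
      using that by (auto simp: spec_le_iff topspace_weak)
    fix p assume p: "p \<in> P"
    have "t0_space (carr (fst p))"
      using source_algebra[OF p] by (simp add: dtop_algebra_def directed_space_def)
    then show "val p c = val p d"
      using that spec_le_continuous_map[OF continuous_map_val_weak[OF p]]
      by (auto simp: t0_space_iff_spec_le_antisym)
  qed
  then have "t0_space weak"
    by (auto simp: t0_space_iff_spec_le_antisym)
  then show ?thesis
    by (simp add: alg_def directed_space_Dtop)
qed

lemma continuous_map_val:
  "p \<in> P \<Longrightarrow> continuous_map (carr alg) (carr (fst p)) (val p)"
  using continuous_map_compose[OF continuous_map_Dtop_id continuous_map_val_weak]
  by (simp add: alg_def o_def)

lemma ops_alg:
  assumes i: "i \<in> symbols S" and a: "a \<in> {..<arity S i} \<rightarrow>\<^sub>E cls ` T"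
  shows "ops alg i a \<in> cls ` T"
    and "p \<in> P \<Longrightarrow> val p (ops alg i a) = ops (fst p) i (\<lambda>k\<in>{..<arity S i}. val p (a k))"
proof -
  let ?t = "Op i (map (\<lambda>k. rep (a k)) [0..<arity S i])"
  have "rep (a k) \<in> T" if "k < arity S i" for k
  proof -
    have "a k \<in> cls ` T"
      using a that by auto
    then show ?thesis
      using rep_cls(1) by auto
  qed
  then have t: "?t \<in> T"
    using i by (intro Op_in_terms_over) auto
  then show "ops alg i a \<in> cls ` T"
    by (simp add: alg_def)
  assume p: "p \<in> P"
  have "val p (ops alg i a) = eval (fst p) (snd p) ?t"
    using val_cls[OF p t] by (simp add: alg_def)
  also have "\<dots> = ops (fst p) i (\<lambda>k\<in>{..<arity S i}. val p (a k))"
    by (subst eval_Op[where n = "arity S i"])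
      (auto simp: val_def intro!: arg_cong[where f = "ops (fst p) i"] restrict_ext)
  finally show "val p (ops alg i a) = \<dots>" .
qed

lemma homomorphism_val: "p \<in> P \<Longrightarrow> homomorphism S alg (fst p) (val p)"
  unfolding homomorphism_def topspace_alg
  by (intro conjI image_subsetI ballI val_in_topspace ops_alg(2))

text \<open>Powers are coreflections, so continuity of an operation need only be checked into the topology
  before coreflection, that is, after each valuation. There the operation becomes the one of the target,
  applied to the power of the valuation.\<close>

lemma dtop_algebra_alg: "dtop_algebra S alg"
  unfolding dtop_algebra_def
proof (intro conjI ballI directed_space_alg)
  fix i assume i: "i \<in> symbols S"
  let ?n = "arity S i"
  have top: "topspace (dir_power (carr alg) ?n) = ({..<?n} \<rightarrow>\<^sub>E cls ` T)"
    by (simp add: topspace_dir_power topspace_alg)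
  have "continuous_map (dir_power (carr alg) ?n) weak (ops alg i)"
  proof (rule continuous_map_into_weak)
    show "ops alg i \<in> topspace (dir_power (carr alg) ?n) \<rightarrow> cls ` T"
      using ops_alg(1)[OF i] by (auto simp: top)
    fix p assume p: "p \<in> P"
    have "continuous_map (dir_power (carr (fst p)) ?n) (carr (fst p)) (ops (fst p) i)"
      using source_algebra[OF p] i by (simp add: dtop_algebra_def)
    from continuous_map_compose[OF continuous_map_dir_power[OF continuous_map_val[OF p]] this]
    show "continuous_map (dir_power (carr alg) ?n) (carr (fst p)) (val p \<circ> ops alg i)"
      by (rule continuous_map_eq) (use ops_alg(2)[OF i _ p] in \<open>simp add: top\<close>)
  qed
  then show "continuous_map (dir_power (carr alg) ?n) (carr alg) (ops alg i)"
    unfolding alg_def dtop_alg.simps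
    by (intro continuous_map_into_Dtop) (simp_all add: dir_power_def Dtop_Dtop)
qed

text \<open>An assignment into the quotient induces an assignment into each target, where the
  inequalities hold.\<close>

lemma satisfies_alg: "satisfies alg E"
  unfolding satisfies_def
proof clarify
  fix t1 t2 and h :: "nat \<Rightarrow> ('i, 'x) trm_class"
  assume E: "(t1, t2) \<in> E" and h: "range h \<subseteq> topspace (carr alg)"
  have t: "t1 \<in> terms_over S UNIV" "t2 \<in> terms_over S UNIV"
    using E inequalities by auto
  have "spec_le weak (eval alg h t1) (eval alg h t2)"
  proof (rule spec_le_weak)
    show "eval alg h t1 \<in> cls ` T" "eval alg h t2 \<in> cls ` T"
      using t h eval_in_topspace[OF dtop_algebra_alg] topspace_alg by blast+
    fix p assume p: "p \<in> P"
    have "range (val p \<circ> h) \<subseteq> topspace (carr (fst p))"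
      using h val_in_topspace[OF p] by (auto simp: topspace_alg)
    then have "spec_le (carr (fst p)) (eval (fst p) (val p \<circ> h) t1) (eval (fst p) (val p \<circ> h) t2)"
      using source_satisfies[OF p] E by (auto simp: satisfies_def)
    then show "spec_le (carr (fst p)) (val p (eval alg h t1)) (val p (eval alg h t2))"
      by (simp only: eval_homomorphism[OF homomorphism_val[OF p] dtop_algebra_alg t(1) h]
          eval_homomorphism[OF homomorphism_val[OF p] dtop_algebra_alg t(2) h])
  qed
  then show "spec_le (carr alg) (eval alg h t1) (eval alg h t2)"
    by (simp add: alg_def spec_le_Dtop)
qed

lemma alg_in_DTopAlg: "alg \<in> DTopAlg S E"
  by (simp add: DTopAlg_def dtop_algebra_alg satisfies_alg)

lemma val_gen: "\<lbrakk>p \<in> P; x \<in> topspace X\<rbrakk> \<Longrightarrow> val p (gen x) = snd p x"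
  by (simp add: gen_def val_cls Var_in_terms_over)

lemma continuous_map_gen: "continuous_map X (carr alg) gen"
proof -
  have "continuous_map X weak gen"
  proof (rule continuous_map_into_weak)
    show "gen \<in> topspace X \<rightarrow> cls ` T"
      by (auto simp: gen_def Var_in_terms_over)
    show "continuous_map X (carr (fst p)) (val p \<circ> gen)" if "p \<in> P" for p
      using source_continuous[OF that] by (rule continuous_map_eq) (simp add: val_gen that)
  qed
  then show ?thesis
    by (simp add: alg_def continuous_map_into_Dtop Dtop_directed_space directed)
qed

lemma val_hom: "p \<in> P \<Longrightarrow> (\<lambda>c\<in>topspace (carr alg). val p c) \<in> DTopAlg_hom S alg (fst p)"
proof -
  assume p: "p \<in> P"
  have "continuous_map (carr alg) (carr (fst p)) (\<lambda>c\<in>topspace (carr alg). val p c)"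
    by (rule continuous_map_eq[OF continuous_map_val[OF p]]) simp
  moreover have "homomorphism S alg (fst p) (\<lambda>c\<in>topspace (carr alg). val p c)"
    unfolding homomorphism_def
  proof (intro conjI ballI)
    fix i a assume i: "i \<in> symbols S" and a: "a \<in> {..<arity S i} \<rightarrow>\<^sub>E topspace (carr alg)"
    have "(\<lambda>k\<in>{..<arity S i}. (\<lambda>c\<in>topspace (carr alg). val p c) (a k))
        = (\<lambda>k\<in>{..<arity S i}. val p (a k))"
      using a by (intro restrict_ext) auto
    then show "(\<lambda>c\<in>topspace (carr alg). val p c) (ops alg i a)
        = ops (fst p) i (\<lambda>k\<in>{..<arity S i}. (\<lambda>c\<in>topspace (carr alg). val p c) (a k))"
      using ops_alg[OF i, of a] a p by (simp add: topspace_alg)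
  qed (use val_in_topspace[OF p] topspace_alg in auto)
  ultimately show ?thesis
    by (simp add: DTopAlg_hom_def DTop_hom_def)
qed

text \<open>The class of a term is the value of that term at the generators: both have the same value in
  each target.\<close>

lemma alg_generated: "topspace (carr alg) \<subseteq> eval alg gen ` T"
proof -
  have "eval alg gen t = cls t" if t: "t \<in> T" for t
  proof (rule val_jointly_injective)
    have g: "gen ` topspace X \<subseteq> topspace (carr alg)"
      by (rule continuous_map_image_subset_topspace[OF continuous_map_gen])
    show "eval alg gen t \<in> cls ` T"
      using eval_in_topspace[OF dtop_algebra_alg t g] by (simp add: topspace_alg)
    show "cls t \<in> cls ` T"
      using t by simp
    fix p assume p: "p \<in> P"
    have "val p (eval alg gen t) = eval (fst p) (val p \<circ> gen) t"
      by (rule eval_homomorphism[OF homomorphism_val[OF p] dtop_algebra_alg t g])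
    also have "\<dots> = eval (fst p) (snd p) t"
      by (rule eval_cong[OF t]) (simp add: val_gen p)
    finally show "val p (eval alg gen t) = val p (cls t)"
      by (simp add: val_cls p t)
  qed
  then show ?thesis
    by (auto simp: topspace_alg)
qed

end

lemma generated_hom_unique:
  assumes A: "dtop_algebra S A" and \<eta>: "\<eta> ` V \<subseteq> topspace (carr A)"
    and gen: "topspace (carr A) \<subseteq> eval A \<eta> ` terms_over S V"
    and g: "g \<in> DTopAlg_hom S A B" and h: "h \<in> DTopAlg_hom S A B"
    and eq: "\<And>v. v \<in> V \<Longrightarrow> g (\<eta> v) = h (\<eta> v)"
  shows "g = h"
proof (rule extensionalityI)
  show "g \<in> extensional (topspace (carr A))" "h \<in> extensional (topspace (carr A))"
    using g h by (auto simp: DTopAlg_hom_def DTop_hom_def)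
  fix a assume "a \<in> topspace (carr A)"
  then obtain t where t: "t \<in> terms_over S V" and a: "a = eval A \<eta> t"
    using gen by blast
  have "g a = eval B (g \<circ> \<eta>) t" "h a = eval B (h \<circ> \<eta>) t"
    using eval_homomorphism[OF _ A t \<eta>] g h a by (auto simp: DTopAlg_hom_def)
  then show "g a = h a"
    using eval_cong[OF t, of "g \<circ> \<eta>" "h \<circ> \<eta>"] eq by simp
qed

section \<open>Free algebras\<close>

lemma free_algebraD:
  assumes "free_algebra TYPE('b) S E X A \<eta>"
  shows "A \<in> DTopAlg S E" "continuous_map X (carr A) \<eta>" "dtop_algebra S A"
    and "x \<in> topspace X \<Longrightarrow> \<eta> x \<in> topspace (carr A)"
    and "\<lbrakk>B \<in> DTopAlg S E; continuous_map X (carr B) f\<rbrakk> \<Longrightarrow>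
      \<exists>!g. g \<in> DTopAlg_hom S A (B :: ('i, 'b) dtop_alg) \<and> (\<forall>x\<in>topspace X. g (\<eta> x) = f x)"
proof -
  show A: "A \<in> DTopAlg S E" and \<eta>: "continuous_map X (carr A) \<eta>"
    using assms by (auto simp: free_algebra_def)
  show "dtop_algebra S A"
    using A by (simp add: DTopAlg_def)
  show "x \<in> topspace X \<Longrightarrow> \<eta> x \<in> topspace (carr A)"
    by (rule funcset_mem[OF continuous_map_funspace[OF \<eta>]])
  show "\<lbrakk>B \<in> DTopAlg S E; continuous_map X (carr B) f\<rbrakk> \<Longrightarrow>
      \<exists>!g. g \<in> DTopAlg_hom S A B \<and> (\<forall>x\<in>topspace X. g (\<eta> x) = f x)"
    using assms by (simp add: free_algebra_def)
qed

text \<open>Every continuous map from \<open>X\<close> into an algebra factors through an algebra on the type of sets of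
  terms, namely a copy of the subalgebra generated by its image. This is how universal properties are
  moved from that type to arbitrary ones.\<close>

lemma single_source_algebra:
  fixes B :: "('i, 'b) dtop_alg" and X :: "'x topology"
  assumes "E \<subseteq> terms S \<times> terms S" "directed_space X"
    and "B \<in> DTopAlg S E" "continuous_map X (carr B) f"
  obtains C :: "('i, ('i, 'x) trm_class) dtop_alg" and \<gamma> e
  where "C \<in> DTopAlg S E" "continuous_map X (carr C) \<gamma>"
    "topspace (carr C) \<subseteq> eval C \<gamma> ` terms_over S (topspace X)"
    "e \<in> DTopAlg_hom S C B" "\<And>x. x \<in> topspace X \<Longrightarrow> e (\<gamma> x) = f x"
proof -
  interpret algebra_source S E X "{(B, f)}"
    by unfold_locales (use assms in auto)
  show thesis
  proof (rule that)
    show "alg \<in> DTopAlg S E" "continuous_map X (carr alg) gen"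
      "topspace (carr alg) \<subseteq> eval alg gen ` T"
      by (rule alg_in_DTopAlg continuous_map_gen alg_generated)+
    show "(\<lambda>c\<in>topspace (carr alg). val (B, f) c) \<in> DTopAlg_hom S alg B"
      using val_hom[of "(B, f)"] by simp
    show "(\<lambda>c\<in>topspace (carr alg). val (B, f) c) (gen x) = f x" if "x \<in> topspace X" for x
      using that val_gen[of "(B, f)" x] continuous_map_image_subset_topspace[OF continuous_map_gen]
      by auto
  qed
qed

text \<open>The target type \<open>'c\<close> is arbitrary but fixed: the set \<open>P\<close> of all pairs exists because all targets
  live on \<open>'c\<close>.\<close>

lemma free_algebra_exists:
  fixes X :: "'x topology" and S :: "'i signature"
  assumes "E \<subseteq> terms S \<times> terms S" "directed_space X"
  shows "\<exists>(A :: ('i, ('i, 'x) trm_class) dtop_alg) \<eta>. free_algebra TYPE('c) S E X A \<eta>"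
proof -
  interpret algebra_source S E X
    "{(B :: ('i, 'c) dtop_alg, f). B \<in> DTopAlg S E \<and> continuous_map X (carr B) f}"
    by unfold_locales (use assms in auto)
  have gen: "gen ` topspace X \<subseteq> topspace (carr alg)"
    by (rule continuous_map_image_subset_topspace[OF continuous_map_gen])
  have "\<exists>!g. g \<in> DTopAlg_hom S alg B \<and> (\<forall>x\<in>topspace X. g (gen x) = f x)"
    if B: "B \<in> DTopAlg S E" and f: "continuous_map X (carr B) f"
    for B :: "('i, 'c) dtop_alg" and f
  proof (rule ex1I)
    show "(\<lambda>c\<in>topspace (carr alg). val (B, f) c) \<in> DTopAlg_hom S alg B \<and>
        (\<forall>x\<in>topspace X. (\<lambda>c\<in>topspace (carr alg). val (B, f) c) (gen x) = f x)"
      using val_hom[of "(B, f)"] val_gen[of "(B, f)"] B f gen by auto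
    then show "g = (\<lambda>c\<in>topspace (carr alg). val (B, f) c)"
      if "g \<in> DTopAlg_hom S alg B \<and> (\<forall>x\<in>topspace X. g (gen x) = f x)" for g
      using that by (intro generated_hom_unique[OF dtop_algebra_alg gen alg_generated]) auto
  qed
  then have "free_algebra TYPE('c) S E X alg gen"
    using alg_in_DTopAlg continuous_map_gen by (simp add: free_algebra_def)
  then show ?thesis
    by blast
qed

text \<open>A free algebra need not be the one constructed above, so that it is generated by its unit requires
  an argument: it is a retract of a copy \<open>C\<close> of the subalgebra generated by the unit. Indeed the
  universal property gives a homomorphism \<open>r\<close> to \<open>C\<close>, and its composite with the inclusion \<open>e\<close> of
  \<open>C\<close> extends the unit along itself, as the identity does.\<close>

lemma free_algebra_generated:
  fixes A :: "('i, ('i, 'x) trm_class) dtop_alg" and X :: "'x topology"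
  assumes E: "E \<subseteq> terms S \<times> terms S" and X: "directed_space X"
    and free: "free_algebra TYPE(('i, 'x) trm_class) S E X A \<eta>"
  shows "topspace (carr A) \<subseteq> eval A \<eta> ` terms_over S (topspace X)"
proof
  fix a assume a: "a \<in> topspace (carr A)"
  note A = free_algebraD(1)[OF free] and \<eta> = free_algebraD(2)[OF free]
    and dA = free_algebraD(3)[OF free] and \<eta>X = free_algebraD(4)[OF free]
    and univ = free_algebraD(5)[OF free]
  obtain C :: "('i, ('i, 'x) trm_class) dtop_alg" and \<gamma> e
    where C: "C \<in> DTopAlg S E" and \<gamma>: "continuous_map X (carr C) \<gamma>"
      and gen: "topspace (carr C) \<subseteq> eval C \<gamma> ` terms_over S (topspace X)"
      and e: "e \<in> DTopAlg_hom S C A" "\<And>x. x \<in> topspace X \<Longrightarrow> e (\<gamma> x) = \<eta> x"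
    by (rule single_source_algebra[OF E X A \<eta>]) blast
  obtain r where r: "r \<in> DTopAlg_hom S A C" "\<And>x. x \<in> topspace X \<Longrightarrow> r (\<eta> x) = \<gamma> x"
    using univ[OF C \<gamma>] by blast
  have dC: "dtop_algebra S C"
    using C by (simp add: DTopAlg_def)
  have "compose (topspace (carr A)) e r = (\<lambda>a\<in>topspace (carr A). a)"
    using univ[OF A \<eta>] DTopAlg_hom_compose[OF r(1) e(1) dA] DTopAlg_hom_id[OF dA] e(2) r(2) \<eta>X
    by (auto simp: compose_eq)
  then have er: "e (r a) = a"
    using a by (metis compose_eq restrict_apply')
  have "r a \<in> topspace (carr C)"
    using r(1) a by (auto simp: DTopAlg_hom_def homomorphism_def)
  then obtain t where t: "t \<in> terms_over S (topspace X)" "r a = eval C \<gamma> t"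
    using gen by blast
  have "a = eval A (e \<circ> \<gamma>) t"
    using eval_homomorphism[OF _ dC t(1) continuous_map_image_subset_topspace[OF \<gamma>]] e(1) er t(2)
    by (auto simp: DTopAlg_hom_def)
  also have "\<dots> = eval A \<eta> t"
    using e(2) by (intro eval_cong[OF t(1)]) simp
  finally show "a \<in> eval A \<eta> ` terms_over S (topspace X)"
    using t(1) by blast
qed

text \<open>Existence of an extension comes from the copy \<open>C\<close> of the subalgebra of the target generated by
  the map. Its uniqueness cannot be read off from the universal property on the other type; it holds
  because the free algebra is generated by its unit.\<close>

lemma free_algebra_any_type:
  fixes A :: "('i, ('i, 'x) trm_class) dtop_alg" and X :: "'x topology"
  assumes E: "E \<subseteq> terms S \<times> terms S" and X: "directed_space X"
    and free: "free_algebra TYPE(('i, 'x) trm_class) S E X A \<eta>"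
  shows "free_algebra TYPE('b) S E X A \<eta>"
proof -
  note A = free_algebraD(1)[OF free] and \<eta> = free_algebraD(2)[OF free]
    and dA = free_algebraD(3)[OF free] and \<eta>X = free_algebraD(4)[OF free]
    and univ = free_algebraD(5)[OF free]
  have "\<exists>!g. g \<in> DTopAlg_hom S A B \<and> (\<forall>x\<in>topspace X. g (\<eta> x) = f x)"
    if B: "B \<in> DTopAlg S E" and f: "continuous_map X (carr B) f"
    for B :: "('i, 'b) dtop_alg" and f
  proof -
    obtain C :: "('i, ('i, 'x) trm_class) dtop_alg" and \<gamma> e
      where C: "C \<in> DTopAlg S E" and \<gamma>: "continuous_map X (carr C) \<gamma>"
        and e: "e \<in> DTopAlg_hom S C B" "\<And>x. x \<in> topspace X \<Longrightarrow> e (\<gamma> x) = f x"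
      by (rule single_source_algebra[OF E X B f]) blast
    obtain r where r: "r \<in> DTopAlg_hom S A C" "\<And>x. x \<in> topspace X \<Longrightarrow> r (\<eta> x) = \<gamma> x"
      using univ[OF C \<gamma>] by blast
    show ?thesis
    proof (rule ex1I)
      show ex: "compose (topspace (carr A)) e r \<in> DTopAlg_hom S A B \<and>
          (\<forall>x\<in>topspace X. compose (topspace (carr A)) e r (\<eta> x) = f x)"
        using DTopAlg_hom_compose[OF r(1) e(1) dA] r(2) e(2) \<eta>X by (auto simp: compose_eq)
      show "g = compose (topspace (carr A)) e r"
        if "g \<in> DTopAlg_hom S A B \<and> (\<forall>x\<in>topspace X. g (\<eta> x) = f x)" for g
        using that ex
        by (intro generated_hom_unique[OF dA _ free_algebra_generated[OF E X free]])
          (auto simp: \<eta>X)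
    qed
  qed
  then show ?thesis
    using A \<eta> by (simp add: free_algebra_def)
qed

section \<open>Free algebras and left adjoints\<close>

lemma free_algebra_imp_left_adjoint:
  fixes F :: "'x topology \<Rightarrow> ('i, 'a) dtop_alg"
  assumes F: "is_functor S E F Fm"
    and free: "\<And>X. directed_space X \<Longrightarrow> free_algebra TYPE('b) S E X (F X) (\<eta> X)"
    and nat: "\<And>X Y f x. \<lbrakk>directed_space X; directed_space Y; f \<in> DTop_hom X Y; x \<in> topspace X\<rbrakk>
        \<Longrightarrow> Fm X Y f (\<eta> X x) = \<eta> Y (f x)"
  shows "left_adjoint_forgetful TYPE('b) S E F Fm"
  unfolding left_adjoint_forgetful_def
proof (intro conjI F exI allI impI ballI)
  let ?\<Phi> = "\<lambda>X (B :: ('i, 'b) dtop_alg) h. compose (topspace X) h (\<eta> X)"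
  note unit = free_algebraD(4)[OF free]
  show "bij_betw (?\<Phi> X B) (DTopAlg_hom S (F X) B) (DTop_hom X (carr B))"
    if "directed_space X \<and> B \<in> DTopAlg S E" for X and B :: "('i, 'b) dtop_alg"
  proof -
    have X: "directed_space X" and B: "B \<in> DTopAlg S E"
      using that by auto
    note \<eta> = free_algebraD(2)[OF free[OF X]] and univ = free_algebraD(5)[OF free[OF X] B]
    have cont: "continuous_map X (carr B) (?\<Phi> X B g)" if "g \<in> DTopAlg_hom S (F X) B" for g
    proof -
      have "continuous_map (carr (F X)) (carr B) g"
        using that by (simp add: DTopAlg_hom_def DTop_hom_def)
      from continuous_map_compose[OF \<eta> this] show ?thesis
        by (rule continuous_map_eq) (simp add: compose_def)
    qed
    show ?thesis
      unfolding bij_betw_def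
    proof (intro conjI inj_onI equalityI subsetI)
      fix g h assume g: "g \<in> DTopAlg_hom S (F X) B" and h: "h \<in> DTopAlg_hom S (F X) B"
        and "?\<Phi> X B g = ?\<Phi> X B h"
      then have "\<forall>x\<in>topspace X. g (\<eta> X x) = ?\<Phi> X B g x" "\<forall>x\<in>topspace X. h (\<eta> X x) = ?\<Phi> X B g x"
        by (metis compose_eq)+
      then show "g = h"
        using univ[OF cont[OF g]] g h by blast
    next
      fix f assume "f \<in> ?\<Phi> X B ` DTopAlg_hom S (F X) B"
      then show "f \<in> DTop_hom X (carr B)"
        using cont by (auto simp: DTop_hom_def)
    next
      fix f assume f: "f \<in> DTop_hom X (carr B)"
      then obtain g where g: "g \<in> DTopAlg_hom S (F X) B" "\<forall>x\<in>topspace X. g (\<eta> X x) = f x"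
        using univ unfolding DTop_hom_def by blast
      have "?\<Phi> X B g = f"
        using f g(2) by (intro extensionalityI[of _ "topspace X"]) (auto simp: DTop_hom_def compose_eq)
      then show "f \<in> ?\<Phi> X B ` DTopAlg_hom S (F X) B"
        using g(1) by blast
    qed
  qed
  show "?\<Phi> X B (compose (topspace (carr (F X))) h (Fm X Y f)) = compose (topspace X) (?\<Phi> Y B h) f"
    if "directed_space X \<and> directed_space Y \<and> B \<in> DTopAlg S E" "f \<in> DTop_hom X Y"
      "h \<in> DTopAlg_hom S (F Y) B" for X Y and B :: "('i, 'b) dtop_alg" and f h
  proof (rule extensionalityI[of _ "topspace X"])
    fix x assume x: "x \<in> topspace X"
    have "f x \<in> topspace Y"
      using that(2) x by (auto simp: DTop_hom_def dest!: continuous_map_funspace)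
    then show "?\<Phi> X B (compose (topspace (carr (F X))) h (Fm X Y f)) x
        = compose (topspace X) (?\<Phi> Y B h) f x"
      using x unit that nat by (simp add: compose_eq)
  qed simp_all
  show "?\<Phi> X C (compose (topspace (carr (F X))) g h) = compose (topspace X) g (?\<Phi> X B h)"
    if "directed_space X \<and> B \<in> DTopAlg S E \<and> C \<in> DTopAlg S E"
    for X and B C :: "('i, 'b) dtop_alg" and g h
    using that unit by (intro extensionalityI[of _ "topspace X"]) (simp_all add: compose_eq)
qed

text \<open>Here the functor takes values in algebras on the same type as the targets, so that \<open>F X\<close>
  itself is a target and its identity has an image under the bijection. Naturality in the target
  shows that the bijection is composition with this unit.\<close>

lemma left_adjoint_imp_free_algebra:
  fixes F :: "'x topology \<Rightarrow> ('i, 'a) dtop_alg"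
  assumes adj: "left_adjoint_forgetful TYPE('a) S E F Fm"
  obtains \<eta> where
    "\<And>X. directed_space X \<Longrightarrow> free_algebra TYPE('a) S E X (F X) (\<eta> X)"
    "\<And>X Y f x. \<lbrakk>directed_space X; directed_space Y; f \<in> DTop_hom X Y; x \<in> topspace X\<rbrakk>
        \<Longrightarrow> Fm X Y f (\<eta> X x) = \<eta> Y (f x)"
proof -
  obtain \<Phi> :: "'x topology \<Rightarrow> ('i, 'a) dtop_alg \<Rightarrow> ('a \<Rightarrow> 'a) \<Rightarrow> ('x \<Rightarrow> 'a)" where \<Phi>:
    "\<forall>X B. directed_space X \<and> B \<in> DTopAlg S E \<longrightarrow>
       bij_betw (\<Phi> X B) (DTopAlg_hom S (F X) B) (DTop_hom X (carr B))"
    "\<forall>X Y B. directed_space X \<and> directed_space Y \<and> B \<in> DTopAlg S E \<longrightarrow>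
       (\<forall>f\<in>DTop_hom X Y. \<forall>h\<in>DTopAlg_hom S (F Y) B.
          \<Phi> X B (compose (topspace (carr (F X))) h (Fm X Y f))
            = compose (topspace X) (\<Phi> Y B h) f)"
    "\<forall>X B C. directed_space X \<and> B \<in> DTopAlg S E \<and> C \<in> DTopAlg S E \<longrightarrow>
       (\<forall>g\<in>DTopAlg_hom S B C. \<forall>h\<in>DTopAlg_hom S (F X) B.
          \<Phi> X C (compose (topspace (carr (F X))) g h)
            = compose (topspace X) g (\<Phi> X B h))"
    using adj unfolding left_adjoint_forgetful_def by blast
  note bij = \<Phi>(1)[rule_format, OF conjI]
    and natX = \<Phi>(2)[rule_format, OF conjI[OF _ conjI]]
    and natB = \<Phi>(3)[rule_format, OF conjI[OF _ conjI]]
  have F: "is_functor S E F Fm"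
    using adj by (simp add: left_adjoint_forgetful_def)
  define idF where "idF X = (\<lambda>a\<in>topspace (carr (F X)). a)" for X
  define \<eta> where "\<eta> X = \<Phi> X (F X) (idF X)" for X
  have FX: "F X \<in> DTopAlg S E" "idF X \<in> DTopAlg_hom S (F X) (F X)" if "directed_space X" for X
    using F that DTopAlg_hom_id[of S "F X"] by (auto simp: is_functor_def DTopAlg_def idF_def)
  have \<eta>_hom: "\<eta> X \<in> DTop_hom X (carr (F X))" if "directed_space X" for X
    using bij_betw_apply[OF bij] FX that by (auto simp: \<eta>_def)
  have \<Phi>_eq: "\<Phi> X B h = compose (topspace X) h (\<eta> X)"
    if X: "directed_space X" and B: "B \<in> DTopAlg S E" and h: "h \<in> DTopAlg_hom S (F X) B" for X B h
  proof -
    have "compose (topspace (carr (F X))) h (idF X) = h"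
      using h by (intro extensionalityI[of _ "topspace (carr (F X))"])
        (auto simp: DTopAlg_hom_def DTop_hom_def compose_eq idF_def)
    then show ?thesis
      using natB[OF X FX(1)[OF X] B h FX(2)[OF X]] by (simp add: \<eta>_def)
  qed
  show thesis
  proof (rule that)
    fix X :: "'x topology" assume X: "directed_space X"
    have "\<exists>!g. g \<in> DTopAlg_hom S (F X) B \<and> (\<forall>x\<in>topspace X. g (\<eta> X x) = f x)"
      if B: "B \<in> DTopAlg S E" and f: "continuous_map X (carr B) f" for B :: "('i, 'a) dtop_alg" and f
    proof -
      have "continuous_map X (carr B) (restrict f (topspace X))"
        by (rule continuous_map_eq[OF f]) simp
      then have f': "restrict f (topspace X) \<in> DTop_hom X (carr B)"
        by (simp add: DTop_hom_def)
      have extends_iff: "(\<forall>x\<in>topspace X. g (\<eta> X x) = f x) \<longleftrightarrow> \<Phi> X B g = restrict f (topspace X)"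
        if "g \<in> DTopAlg_hom S (F X) B" for g
        unfolding \<Phi>_eq[OF X B that] by (auto simp: fun_eq_iff compose_def restrict_def)
      obtain g where g: "g \<in> DTopAlg_hom S (F X) B" "\<Phi> X B g = restrict f (topspace X)"
        using f' bij_betw_imp_surj_on[OF bij[OF X B]] by (metis imageE)
      show ?thesis
      proof (rule ex1I)
        show "g \<in> DTopAlg_hom S (F X) B \<and> (\<forall>x\<in>topspace X. g (\<eta> X x) = f x)"
          using g extends_iff by simp
        show "h = g"
          if "h \<in> DTopAlg_hom S (F X) B \<and> (\<forall>x\<in>topspace X. h (\<eta> X x) = f x)" for h
          using that g extends_iff[of h] inj_onD[OF bij_betw_imp_inj_on[OF bij[OF X B]], of h g]
          by simp
      qed
    qed
    then show "free_algebra TYPE('a) S E X (F X) (\<eta> X)"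
      using FX(1)[OF X] \<eta>_hom[OF X] by (auto simp: free_algebra_def DTop_hom_def)
  next
    fix X Y :: "'x topology" and f x
    assume X: "directed_space X" and Y: "directed_space Y" and f: "f \<in> DTop_hom X Y"
      and x: "x \<in> topspace X"
    have Ff: "Fm X Y f \<in> DTopAlg_hom S (F X) (F Y)"
      using F X Y f unfolding is_functor_def by blast
    have "compose (topspace (carr (F X))) (idF Y) (Fm X Y f) = Fm X Y f"
      using Ff by (intro extensionalityI[of _ "topspace (carr (F X))"])
        (auto simp: DTopAlg_hom_def DTop_hom_def homomorphism_def compose_eq idF_def)
    then have "\<Phi> X (F Y) (Fm X Y f) = compose (topspace X) (\<eta> Y) f"
      using natX[OF X Y FX(1)[OF Y] f FX(2)[OF Y]] by (simp add: \<eta>_def)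
    then have "compose (topspace X) (Fm X Y f) (\<eta> X) = compose (topspace X) (\<eta> Y) f"
      by (simp add: \<Phi>_eq[OF X FX(1)[OF Y] Ff])
    then show "Fm X Y f (\<eta> X x) = \<eta> Y (f x)"
      using x by (metis compose_eq)
  qed
qed

text \<open>On morphisms the functor is forced by naturality of the unit; the functor laws hold because
  both sides extend the same map.\<close>

lemma free_algebras_functor:
  fixes F :: "'x topology \<Rightarrow> ('i, 'a) dtop_alg"
  assumes free: "\<And>X. directed_space X \<Longrightarrow> free_algebra TYPE('a) S E X (F X) (\<eta> X)"
  obtains Fm where "is_functor S E F Fm"
    "\<And>X Y f x. \<lbrakk>directed_space X; directed_space Y; f \<in> DTop_hom X Y; x \<in> topspace X\<rbrakk>
        \<Longrightarrow> Fm X Y f (\<eta> X x) = \<eta> Y (f x)"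
proof -
  note FX = free_algebraD(1-3)[OF free] and unit = free_algebraD(4)[OF free]
  define lifts where "lifts X Y f g \<longleftrightarrow>
      g \<in> DTopAlg_hom S (F X) (F Y) \<and> (\<forall>x\<in>topspace X. g (\<eta> X x) = \<eta> Y (f x))" for X Y f g
  define Fm where "Fm X Y f = (THE g. lifts X Y f g)" for X Y f
  have ex1: "\<exists>!g. lifts X Y f g" if "directed_space X" "directed_space Y" "f \<in> DTop_hom X Y" for X Y f
  proof -
    have "continuous_map X (carr (F Y)) (\<lambda>x. \<eta> Y (f x))"
      using continuous_map_compose[of X Y f _ "\<eta> Y"] FX(2)[OF that(2)] that(3)
      by (auto simp: DTop_hom_def o_def)
    then show ?thesis
      unfolding lifts_def by (rule free_algebraD(5)[OF free[OF that(1)] FX(1)[OF that(2)]])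
  qed
  have lifts: "lifts X Y f (Fm X Y f)"
    if "directed_space X" "directed_space Y" "f \<in> DTop_hom X Y" for X Y f
    using theI'[OF ex1[OF that]] by (simp add: Fm_def)
  have eqI: "Fm X Y f = g"
    if "directed_space X" "directed_space Y" "f \<in> DTop_hom X Y" "lifts X Y f g" for X Y f g
    using the1_equality[OF ex1[OF that(1-3)], OF that(4)] by (simp add: Fm_def)
  show thesis
  proof (rule that)
    show "is_functor S E F Fm"
      unfolding is_functor_def
    proof (intro conjI allI impI ballI)
      fix X :: "'x topology" assume X: "directed_space X"
      show "F X \<in> DTopAlg S E"
        by (rule FX(1)[OF X])
      have "continuous_map X X (\<lambda>x\<in>topspace X. x)"
        by (rule continuous_map_eq[OF continuous_map_id]) simp
      then show "Fm X X (\<lambda>x\<in>topspace X. x) = (\<lambda>a\<in>topspace (carr (F X)). a)"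
        using DTopAlg_hom_id[OF FX(3)[OF X]] unit[OF X]
        by (intro eqI X) (auto simp: DTop_hom_def lifts_def)
    next
      fix X Y :: "'x topology" and f
      assume "directed_space X \<and> directed_space Y" "f \<in> DTop_hom X Y"
      then show "Fm X Y f \<in> DTopAlg_hom S (F X) (F Y)"
        using lifts by (auto simp: lifts_def)
    next
      fix X Y Z :: "'x topology" and f g
      assume XYZ: "directed_space X \<and> directed_space Y \<and> directed_space Z"
        and f: "f \<in> DTop_hom X Y" and g: "g \<in> DTop_hom Y Z"
      have fY: "f x \<in> topspace Y" if "x \<in> topspace X" for x
        using f that by (auto simp: DTop_hom_def dest!: continuous_map_funspace)
      have "lifts X Y f (Fm X Y f)" "lifts Y Z g (Fm Y Z g)"
        using XYZ f g lifts by blast+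
      then have "lifts X Z (compose (topspace X) g f)
          (compose (topspace (carr (F X))) (Fm Y Z g) (Fm X Y f))"
        using DTopAlg_hom_compose[of "Fm X Y f" S "F X" "F Y" "Fm Y Z g" "F Z"] FX(3) XYZ unit fY
        unfolding lifts_def by (auto simp: compose_eq)
      then show "Fm X Z (compose (topspace X) g f)
          = compose (topspace (carr (F X))) (Fm Y Z g) (Fm X Y f)"
        using XYZ DTop_hom_compose[OF f g] by (intro eqI) auto
    qed
    show "Fm X Y f (\<eta> X x) = \<eta> Y (f x)"
      if "directed_space X" "directed_space Y" "f \<in> DTop_hom X Y" "x \<in> topspace X" for X Y f x
      using lifts that by (auto simp: lifts_def)
  qed
qed

theorem theorem3p5:
  fixes S :: "'i signature" and E :: "'i inequality set"
  assumes "E \<subseteq> terms S \<times> terms S"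
  shows
    "((\<exists>(F :: 'x topology \<Rightarrow> ('i, ('i, 'x) trm_class) dtop_alg) Fm.
         left_adjoint_forgetful TYPE(('i, 'x) trm_class) S E F Fm) \<and>
      (\<forall>(F :: 'x topology \<Rightarrow> ('i, ('i, 'x) trm_class) dtop_alg) Fm.
         left_adjoint_forgetful TYPE(('i, 'x) trm_class) S E F Fm \<longrightarrow>
         left_adjoint_forgetful TYPE('b) S E F Fm)) \<and>
     (\<forall>X :: 'x topology. directed_space X \<longrightarrow>
        (\<exists>(A :: ('i, ('i, 'x) trm_class) dtop_alg) \<eta>.
           free_algebra TYPE(('i, 'x) trm_class) S E X A \<eta>) \<and>
        (\<forall>(A :: ('i, ('i, 'x) trm_class) dtop_alg) \<eta>.
           free_algebra TYPE(('i, 'x) trm_class) S E X A \<eta> \<longrightarrow>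
           free_algebra TYPE('b) S E X A \<eta>))"
proof (intro conjI allI impI)
  obtain F :: "'x topology \<Rightarrow> ('i, ('i, 'x) trm_class) dtop_alg" and \<eta>
    where free: "\<And>X. directed_space X \<Longrightarrow>
      free_algebra TYPE(('i, 'x) trm_class) S E X (F X) (\<eta> X)"
    using free_algebra_exists[OF assms] by metis
  obtain Fm where "is_functor S E F Fm"
    "\<And>X Y f x. \<lbrakk>directed_space X; directed_space Y; f \<in> DTop_hom X Y; x \<in> topspace X\<rbrakk>
        \<Longrightarrow> Fm X Y f (\<eta> X x) = \<eta> Y (f x)"
    using free_algebras_functor[OF free] by blast
  from free_algebra_imp_left_adjoint[OF this(1) free this(2)]
  show "\<exists>(F :: 'x topology \<Rightarrow> ('i, ('i, 'x) trm_class) dtop_alg) Fm.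
      left_adjoint_forgetful TYPE(('i, 'x) trm_class) S E F Fm"
    by blast
next
  fix F :: "'x topology \<Rightarrow> ('i, ('i, 'x) trm_class) dtop_alg" and Fm
  assume adj: "left_adjoint_forgetful TYPE(('i, 'x) trm_class) S E F Fm"
  then have F: "is_functor S E F Fm"
    by (simp add: left_adjoint_forgetful_def)
  obtain \<eta> where
    free: "\<And>X. directed_space X \<Longrightarrow> free_algebra TYPE(('i, 'x) trm_class) S E X (F X) (\<eta> X)"
    and nat: "\<And>X Y f x. \<lbrakk>directed_space X; directed_space Y; f \<in> DTop_hom X Y; x \<in> topspace X\<rbrakk>
        \<Longrightarrow> Fm X Y f (\<eta> X x) = \<eta> Y (f x)"
    by (rule left_adjoint_imp_free_algebra[OF adj]) blast
  show "left_adjoint_forgetful TYPE('b) S E F Fm"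
    by (rule free_algebra_imp_left_adjoint[OF F free_algebra_any_type[OF assms _ free] nat])
next
  fix X :: "'x topology" assume X: "directed_space X"
  show "\<exists>(A :: ('i, ('i, 'x) trm_class) dtop_alg) \<eta>.
      free_algebra TYPE(('i, 'x) trm_class) S E X A \<eta>"
    by (rule free_algebra_exists[OF assms X])
  fix A :: "('i, ('i, 'x) trm_class) dtop_alg" and \<eta>
  assume "free_algebra TYPE(('i, 'x) trm_class) S E X A \<eta>"
  then show "free_algebra TYPE('b) S E X A \<eta>"
    by (rule free_algebra_any_type[OF assms X])
qed

end
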